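(* For all integers $\xi\ge1$ and $k\ge1$ there exist ordered colored graphs $G[\varrho,\gamma]$ and $H[\varrho',\gamma']$ and rule-bases $\mathcal R$ and $\mathcal R'$ such that $${\rm Wsdn}^k(G[\varrho],\gamma,\mathcal R)-{\rm Wsdn}^{k+1}(G[\varrho],\gamma,\mathcal R)=\xi$$ and $${\rm Ssdn}^k(H[\varrho'],\gamma',\mathcal R')-{\rm Ssdn}^{k+1}(H[\varrho'],\gamma',\mathcal R')=\xi.$$
   Context: All graphs are finite and simple. For an integer $t\ge1$, a list assignment on a graph $G$ is a family $\mathcal L=(L_v)_{v\in V(G)}$ with $L_v\subseteq\{1,\dots,t\}$; write $\mathcal L\subseteq\mathcal L'$ if $L_v\subseteq L'_v$ for all $v$. A solution of the list coloring problem $(G,\mathcal L,t)$ is a proper coloring $\sigma:V(G)\to\{1,\dots,t\}$ with $\sigma(v)\in L_v$ for all $v$. An ordered graph $G[\varrho]$ is a graph on $n$ vertices with a bijection $\varrho:\{1,\dots,n\}\to V(G)$, $v_i=\varrho(i)$; an ordered colored graph $G[\varrho,\gamma]$ additionally carries a proper $t$-coloring $\gamma$. A local $t$-coloring rule on a base graph $H$ is a map sending list assignments $\mathcal L$ on $H$ to list assignments $\mathcal L'$ on $H$ such that (a) $L'_v\subseteq L_v$; (b) $(H,\mathcal L,t)$ and $(H,\mathcal L',t)$ have the same set of solutions; (c) $\mathcal L_1\subseteq \mathcal L_2$ implies $\mathcal L_1'\subseteq\mathcal L_2'$. A ($d$-bounded) $t$-coloring rule-base $\mathcal R$ is a finite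 set of $r\ge0$ structural rules $R_1,\dots,R_r$ (local $t$-coloring rules on base graphs $H_i$ of diameter at most $d$) and possibly one nonstructural rule $R^*$, a procedure replacing the list $L$ of a vertex by some $L'\subseteq L$, compatible with $R^{Tu}_1(2)$ (if one end of an edge has list $\{c\}$, remove $c$ from the other end's list) but not required to satisfy (b),(c). Standing assumption: every rule-base contains $R^{Tu}_1(2)$. Algorithm OLG-$\mathcal R$-Col on input $(G[\varrho],\mathcal L,t,d)$ works in rounds. In each round, for $i=1,\dots,n$ in order, it updates $L_{v_i}$ by applying the structural rules of $\mathcal R$ to all subgraphs of the ball of radius $d$ around $v_i$ (fixed canonical order), changing only $L_{v_i}$, then applying $R^*$ if present; if $L_{v_i}$ becomes empty it halts with failure. After the pass, the counter $rounds$ (initially $0$) increases by $1$; if every $v_i$ had $|L_{v_i}|=1$ after its update in this pass, it halts and returns the lists; otherwise a new round starts. The problem is $(\mathcal R,d)$-solvable if the algorithm halts without failure after finitely many rounds, returning singleton lists forming a proper $t$-coloring. For $A\subseteq V(G)$, $\mathcal L^{A,\gamma}_v=\{\gamma(v)\}$ for $v\in A$ and $\{1,\dots,t\}$ otherwise. $A$ is a $k$-bounded sequential $\mathcal R$-defining set for $G[\varrho,\gamma]$ if $(G[\varrho],\mathcal L^{A,\gamma},t)$ is $(\mathcal R,d)$-solvable, the algorithm returns $\gamma$, and $rounds\le k$; its index is $|A|+rounds-1$. ${\rm Wsdn}^k(G[\varrho],\gamma,\mathcal R)$ and ${\rm Ssdn}^k(G[\varrho],\gamma,\mathcal R)$ are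 the minimum size and the minimum index, respectively, of a $k$-bounded sequential $\mathcal R$-defining set. *)

theory Defs
  imports Main "HOL-Library.List_Lexorder"
begin

record 'a graph =
  verts :: "'a set"
  edges :: "'a set set"

definition simple_graph :: "'a graph \<Rightarrow> bool" where
  "simple_graph G \<longleftrightarrow> finite (verts G) \<and> (\<forall>e\<in>edges G. e \<subseteq> verts G \<and> card e = 2)"

definition adj_rel :: "'a graph \<Rightarrow> ('a \<times> 'a) set" where
  "adj_rel G = {(u, v). {u, v} \<in> edges G}"

definition dist_le :: "'a graph \<Rightarrow> nat \<Rightarrow> 'a \<Rightarrow> 'a \<Rightarrow> bool" where
  "dist_le G d u v \<longleftrightarrow> (\<exists>j\<le>d. (u, v) \<in> adj_rel G ^^ j)"

definition ball_around :: "'a graph \<Rightarrow> nat \<Rightarrow> 'a \<Rightarrow> 'a set" where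
  "ball_around G d v = {u \<in> verts G. dist_le G d v u}"

definition diameter_le :: "'a graph \<Rightarrow> nat \<Rightarrow> bool" where
  "diameter_le G d \<longleftrightarrow> verts G \<noteq> {} \<and> (\<forall>u\<in>verts G. \<forall>v\<in>verts G. dist_le G d u v)"

definition proper_coloring :: "nat \<Rightarrow> 'a graph \<Rightarrow> ('a \<Rightarrow> nat) \<Rightarrow> bool" where
  "proper_coloring t G \<sigma> \<longleftrightarrow>
     (\<forall>v\<in>verts G. \<sigma> v \<in> {1..t}) \<and> (\<forall>u v. {u, v} \<in> edges G \<longrightarrow> \<sigma> u \<noteq> \<sigma> v)"

definition ordered_graph :: "'a graph \<Rightarrow> (nat \<Rightarrow> 'a) \<Rightarrow> bool" where
  "ordered_graph G \<rho> \<longleftrightarrow> simple_graph G \<and> bij_betw \<rho> {1..card (verts G)} (verts G)"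

definition ordered_colored_graph ::
    "nat \<Rightarrow> 'a graph \<Rightarrow> (nat \<Rightarrow> 'a) \<Rightarrow> ('a \<Rightarrow> nat) \<Rightarrow> bool" where
  "ordered_colored_graph t G \<rho> \<gamma> \<longleftrightarrow> ordered_graph G \<rho> \<and> proper_coloring t G \<gamma>"

type_synonym 'a lists = "'a \<Rightarrow> nat set"

definition list_assignment :: "nat \<Rightarrow> 'a graph \<Rightarrow> 'a lists \<Rightarrow> bool" where
  "list_assignment t G L \<longleftrightarrow> (\<forall>v\<in>verts G. L v \<subseteq> {1..t})"

definition lists_le :: "'a graph \<Rightarrow> 'a lists \<Rightarrow> 'a lists \<Rightarrow> bool" where
  "lists_le G L L' \<longleftrightarrow> (\<forall>v\<in>verts G. L v \<subseteq> L' v)"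

definition list_solution :: "nat \<Rightarrow> 'a graph \<Rightarrow> 'a lists \<Rightarrow> ('a \<Rightarrow> nat) \<Rightarrow> bool" where
  "list_solution t G L \<sigma> \<longleftrightarrow> proper_coloring t G \<sigma> \<and> (\<forall>v\<in>verts G. \<sigma> v \<in> L v)"

text \<open>A structural rule is a base graph, whose vertices are labelled \<open>0, \<dots>, m - 1\<close>, together with
  the map on its list assignments. Values of list assignments off the vertex set are irrelevant:
  the monotonicity condition makes the map insensitive to them.\<close>

type_synonym structural_rule = "nat graph \<times> (nat lists \<Rightarrow> nat lists)"

definition local_rule :: "nat \<Rightarrow> structural_rule \<Rightarrow> bool" where
  "local_rule t r \<longleftrightarrow> (case r of (H, f) \<Rightarrow>
     simple_graph H \<and> verts H = {..<card (verts H)} \<and>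
     (\<forall>L. list_assignment t H L \<longrightarrow>
        lists_le H (f L) L \<and> {\<sigma>. list_solution t H (f L) \<sigma>} = {\<sigma>. list_solution t H L \<sigma>}) \<and>
     (\<forall>L1 L2. list_assignment t H L1 \<and> list_assignment t H L2 \<and> lists_le H L1 L2 \<longrightarrow>
        lists_le H (f L1) (f L2)))"

text \<open>The rule \<open>R\<^sup>T\<^sup>u\<^sub>1(2)\<close> on \<open>K\<^sub>2\<close>. If the list of the neighbour \<open>u\<close> is nonempty, then \<open>L u \<subseteq> {c}\<close> says
  \<open>L u = {c}\<close>. If it is empty, all colours are removed; monotonicity forces this extension, since
  the empty list is contained in \<open>{c}\<close> for every \<open>c\<close>.\<close>

definition K2 :: "nat graph" where
  "K2 = \<lparr>verts = {0, 1}, edges = {{0, 1}}\<rparr>"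

definition tuza_rule :: structural_rule where
  "tuza_rule = (K2, \<lambda>L v. {c \<in> L v. \<not> (\<exists>u. {u, v} \<in> edges K2 \<and> L u \<subseteq> {c})})"

text \<open>The nonstructural rule returns the new list of a vertex, given the current state of the
  algorithm (ordered graph and lists).\<close>

type_synonym 'a nonstructural_rule =
  "'a graph \<Rightarrow> (nat \<Rightarrow> 'a) \<Rightarrow> 'a lists \<Rightarrow> 'a \<Rightarrow> nat set"

text \<open>Compatibility with \<open>R\<^sup>T\<^sup>u\<^sub>1(2)\<close>: the new list contains no colour that this rule would delete.\<close>

definition nonstructural_rule_ok :: "nat \<Rightarrow> 'a nonstructural_rule \<Rightarrow> bool" where
  "nonstructural_rule_ok t S \<longleftrightarrow>
     (\<forall>G \<rho> L. ordered_graph G \<rho> \<and> list_assignment t G L \<longrightarrow>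
        (\<forall>v\<in>verts G. S G \<rho> L v \<subseteq> L v \<and>
           (\<forall>u c. {u, v} \<in> edges G \<and> L u = {c} \<longrightarrow> c \<notin> S G \<rho> L v)))"

record 'a rule_base =
  num_colors :: nat
  radius :: nat
  structural :: "structural_rule list"
  nonstructural :: "'a nonstructural_rule option"

definition is_rule_base :: "'a rule_base \<Rightarrow> bool" where
  "is_rule_base R \<longleftrightarrow>
     1 \<le> num_colors R \<and>
     (\<forall>r\<in>set (structural R). local_rule (num_colors R) r \<and> diameter_le (fst r) (radius R)) \<and>
     tuza_rule \<in> set (structural R) \<and>
     (\<forall>S. nonstructural R = Some S \<longrightarrow> nonstructural_rule_ok (num_colors R) S)"

text \<open>The copies of \<open>H\<close> in the ball of radius \<open>d\<close> around \<open>v\<close>, not necessarily induced. A copy is the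
  list \<open>ps\<close> of the positions, in the vertex order, of the images of the vertices \<open>0, \<dots>, m - 1\<close> of
  \<open>H\<close>; the canonical order of the copies is the lexicographic order of these lists.\<close>

definition copy_map :: "(nat \<Rightarrow> 'a) \<Rightarrow> nat list \<Rightarrow> nat \<Rightarrow> 'a" where
  "copy_map \<rho> ps j = \<rho> (ps ! j)"

definition copies :: "'a graph \<Rightarrow> (nat \<Rightarrow> 'a) \<Rightarrow> nat \<Rightarrow> nat graph \<Rightarrow> 'a \<Rightarrow> nat list list" where
  "copies G \<rho> d H v = sorted_list_of_set
     {ps. length ps = card (verts H) \<and> distinct ps \<and> set ps \<subseteq> {1..card (verts G)} \<and>
          copy_map \<rho> ps ` verts H \<subseteq> ball_around G d v \<and>
          (\<forall>e\<in>edges H. copy_map \<rho> ps ` e \<in> edges G)}"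

definition apply_copy ::
    "structural_rule \<Rightarrow> (nat \<Rightarrow> 'a) \<Rightarrow> 'a \<Rightarrow> 'a lists \<Rightarrow> nat list \<Rightarrow> 'a lists" where
  "apply_copy r \<rho> v L ps = (case r of (H, f) \<Rightarrow>
     if v \<in> copy_map \<rho> ps ` verts H
     then L(v := f (L \<circ> copy_map \<rho> ps) (inv_into (verts H) (copy_map \<rho> ps) v))
     else L)"

definition structural_update ::
    "'a rule_base \<Rightarrow> 'a graph \<Rightarrow> (nat \<Rightarrow> 'a) \<Rightarrow> 'a \<Rightarrow> 'a lists \<Rightarrow> 'a lists" where
  "structural_update R G \<rho> v L =
     foldl (\<lambda>L r. foldl (apply_copy r \<rho> v) L (copies G \<rho> (radius R) (fst r) v)) L (structural R)"

definition update ::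
    "'a rule_base \<Rightarrow> 'a graph \<Rightarrow> (nat \<Rightarrow> 'a) \<Rightarrow> 'a \<Rightarrow> 'a lists \<Rightarrow> 'a lists" where
  "update R G \<rho> v L =
     (let L' = structural_update R G \<rho> v L in
      case nonstructural R of None \<Rightarrow> L' | Some S \<Rightarrow> L'(v := S G \<rho> L' v))"

text \<open>\<open>None\<close> stands for failure.\<close>

definition update_step ::
    "'a rule_base \<Rightarrow> 'a graph \<Rightarrow> (nat \<Rightarrow> 'a) \<Rightarrow> 'a \<Rightarrow> 'a lists \<Rightarrow> 'a lists option" where
  "update_step R G \<rho> v L =
     (let L' = update R G \<rho> v L in if L' v = {} then None else Some L')"

definition pass ::
    "'a rule_base \<Rightarrow> 'a graph \<Rightarrow> (nat \<Rightarrow> 'a) \<Rightarrow> 'a lists \<Rightarrow> 'a lists option" where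
  "pass R G \<rho> L =
     foldl (\<lambda>s i. Option.bind s (update_step R G \<rho> (\<rho> i))) (Some L) [1..<card (verts G) + 1]"

text \<open>\<open>olg_col R G \<rho> L r L'\<close>: started on \<open>L\<close>, the algorithm halts without failure with \<open>rounds = r\<close>
  and returns \<open>L'\<close>. A list changes only at the update of its own vertex, so the lists after the
  individual updates of a pass are the lists at its end.\<close>

inductive olg_col ::
    "'a rule_base \<Rightarrow> 'a graph \<Rightarrow> (nat \<Rightarrow> 'a) \<Rightarrow> 'a lists \<Rightarrow> nat \<Rightarrow> 'a lists \<Rightarrow> bool"
  for R G \<rho> where
    halt: "pass R G \<rho> L = Some L' \<Longrightarrow> \<forall>v\<in>verts G. card (L' v) = 1 \<Longrightarrow>
      olg_col R G \<rho> L 1 L'"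
  | continue: "pass R G \<rho> L = Some L' \<Longrightarrow> \<not> (\<forall>v\<in>verts G. card (L' v) = 1) \<Longrightarrow>
      olg_col R G \<rho> L' r L'' \<Longrightarrow> olg_col R G \<rho> L (Suc r) L''"

definition solvable :: "'a rule_base \<Rightarrow> 'a graph \<Rightarrow> (nat \<Rightarrow> 'a) \<Rightarrow> 'a lists \<Rightarrow> bool" where
  "solvable R G \<rho> L \<longleftrightarrow>
     (\<exists>r L' \<sigma>. olg_col R G \<rho> L r L' \<and> proper_coloring (num_colors R) G \<sigma> \<and>
               (\<forall>v\<in>verts G. L' v = {\<sigma> v}))"

definition rounds :: "'a rule_base \<Rightarrow> 'a graph \<Rightarrow> (nat \<Rightarrow> 'a) \<Rightarrow> 'a lists \<Rightarrow> nat" where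
  "rounds R G \<rho> L = (THE r. \<exists>L'. olg_col R G \<rho> L r L')"

definition init_lists :: "nat \<Rightarrow> 'a set \<Rightarrow> ('a \<Rightarrow> nat) \<Rightarrow> 'a lists" where
  "init_lists t A \<gamma> v = (if v \<in> A then {\<gamma> v} else {1..t})"

definition seq_defining_set ::
    "nat \<Rightarrow> 'a graph \<Rightarrow> (nat \<Rightarrow> 'a) \<Rightarrow> ('a \<Rightarrow> nat) \<Rightarrow> 'a rule_base \<Rightarrow> 'a set \<Rightarrow> bool" where
  "seq_defining_set k G \<rho> \<gamma> R A \<longleftrightarrow>
     A \<subseteq> verts G \<and>
     (let L = init_lists (num_colors R) A \<gamma> in
        solvable R G \<rho> L \<and>
        (\<exists>r L'. olg_col R G \<rho> L r L' \<and> (\<forall>v\<in>verts G. L' v = {\<gamma> v})) \<and>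
        rounds R G \<rho> L \<le> k)"

definition defining_index ::
    "'a graph \<Rightarrow> (nat \<Rightarrow> 'a) \<Rightarrow> ('a \<Rightarrow> nat) \<Rightarrow> 'a rule_base \<Rightarrow> 'a set \<Rightarrow> nat" where
  "defining_index G \<rho> \<gamma> R A =
     card A + rounds R G \<rho> (init_lists (num_colors R) A \<gamma>) - 1"

definition Wsdn ::
    "nat \<Rightarrow> 'a graph \<Rightarrow> (nat \<Rightarrow> 'a) \<Rightarrow> ('a \<Rightarrow> nat) \<Rightarrow> 'a rule_base \<Rightarrow> nat" where
  "Wsdn k G \<rho> \<gamma> R = Min (card ` {A. seq_defining_set k G \<rho> \<gamma> R A})"

definition Ssdn ::
    "nat \<Rightarrow> 'a graph \<Rightarrow> (nat \<Rightarrow> 'a) \<Rightarrow> ('a \<Rightarrow> nat) \<Rightarrow> 'a rule_base \<Rightarrow> nat" where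
  "Ssdn k G \<rho> \<gamma> R = Min (defining_index G \<rho> \<gamma> R ` {A. seq_defining_set k G \<rho> \<gamma> R A})"

end

theory Submission
  imports Defs
begin

text \<open>
  With two colours and only \<open>R\<^sup>T\<^sup>u\<^sub>1(2)\<close>, the lists are determined by the set of vertices whose colour is
  already known, and an update makes a vertex known iff it has a known neighbour. Take a spider
  with \<open>M\<close> legs of length \<open>k + 1\<close> and process the vertices from the tips towards the centre: colours
  travel towards the centre within one round, but outwards only one step per round. The centre
  alone is therefore a defining set that needs \<open>k + 1\<close> rounds, the set of all tips needs a single
  round, and a set that succeeds in \<open>k\<close> rounds has to meet each of the \<open>M\<close> legs. Hence the weak
  numbers for \<open>k\<close> and \<open>k + 1\<close> are \<open>M\<close> and \<open>1\<close>, the strong ones \<open>M\<close> and \<open>k + 1\<close> if \<open>M > k\<close>.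
\<close>

section \<open>Two colours and the rule on an edge\<close>

definition tuza_base :: "'a rule_base" where
  "tuza_base = \<lparr>num_colors = 2, radius = 1, structural = [tuza_rule], nonstructural = None\<rparr>"

lemma tuza_base_simps [simp]:
  "num_colors tuza_base = 2" "radius tuza_base = 1"
  "structural tuza_base = [tuza_rule]" "nonstructural tuza_base = None"
  by (simp_all add: tuza_base_def)

lemma K2_simps [simp]:
  "verts K2 = {0, 1}" "edges K2 = {{0, 1}}"
  by (simp_all add: K2_def)

lemma simple_graph_K2: "simple_graph K2"
  by (auto simp: simple_graph_def)

lemma tuza_rule_apply: "c \<in> snd tuza_rule L v \<longleftrightarrow>
    c \<in> L v \<and> (v = 0 \<longrightarrow> \<not> L 1 \<subseteq> {c}) \<and> (v = 1 \<longrightarrow> \<not> L 0 \<subseteq> {c})"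
  by (auto simp: tuza_rule_def doubleton_eq_iff)

lemma proper_coloring_K2:
  "proper_coloring t K2 \<sigma> \<longleftrightarrow> \<sigma> 0 \<in> {1..t} \<and> \<sigma> 1 \<in> {1..t} \<and> \<sigma> 0 \<noteq> \<sigma> 1"
proof -
  have "(\<forall>u v. {u, v} \<in> edges K2 \<longrightarrow> \<sigma> u \<noteq> \<sigma> v) \<longleftrightarrow> \<sigma> 0 \<noteq> \<sigma> 1"
    by (auto simp: doubleton_eq_iff)
  then show ?thesis unfolding proper_coloring_def by simp
qed

text \<open>A colour is deleted at one end only if the list of the other end lies inside that single
  colour. A solution uses a different colour there, so it survives. Larger lists satisfy this
  containment less often, whence monotonicity.\<close>

lemma local_rule_tuza: "local_rule t tuza_rule"
proof -
  let ?f = "snd tuza_rule"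
  have le: "lists_le K2 (?f L) L" for L
    by (simp add: lists_le_def subset_iff tuza_rule_apply)
  have sol: "list_solution t K2 (?f L) \<sigma> \<longleftrightarrow> list_solution t K2 L \<sigma>" for L \<sigma>
  proof (cases "proper_coloring t K2 \<sigma>")
    case True
    then have "\<sigma> 0 \<noteq> \<sigma> 1" by (simp add: proper_coloring_K2)
    then have "\<sigma> 0 \<in> ?f L 0 \<and> \<sigma> 1 \<in> ?f L 1 \<longleftrightarrow> \<sigma> 0 \<in> L 0 \<and> \<sigma> 1 \<in> L 1"
      by (auto simp: tuza_rule_apply)
    then show ?thesis by (simp add: list_solution_def)
  qed (simp add: list_solution_def)
  have mono: "lists_le K2 (?f L1) (?f L2)" if "lists_le K2 L1 L2" for L1 L2
  proof -
    have "L1 0 \<subseteq> L2 0" "L1 1 \<subseteq> L2 1" using that by (simp_all add: lists_le_def)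
    then have "?f L1 0 \<subseteq> ?f L2 0" "?f L1 1 \<subseteq> ?f L2 1"
      by (simp_all add: subset_iff tuza_rule_apply) blast+
    then show ?thesis by (simp add: lists_le_def)
  qed
  have verts: "verts K2 = {..<card (verts K2)}" by auto
  have rule: "tuza_rule = (K2, ?f)" by (simp add: tuza_rule_def)
  show ?thesis
    unfolding local_rule_def by (subst rule, unfold prod.case)
      (intro conjI allI impI simple_graph_K2 verts le mono Collect_cong sol; simp)
qed

lemma diameter_K2: "diameter_le K2 1"
proof -
  have "dist_le K2 1 u v" if "u \<in> {0, 1}" "v \<in> {0, 1}" for u v
  proof (cases "u = v")
    case True
    then show ?thesis unfolding dist_le_def by (intro exI[of _ 0]) auto
  next
    case False
    then show ?thesis using that unfolding dist_le_def
      by (intro exI[of _ 1]) (auto simp: adj_rel_def)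
  qed
  then show ?thesis by (auto simp: diameter_le_def)
qed

lemma is_rule_base_tuza_base: "is_rule_base tuza_base"
  using local_rule_tuza diameter_K2 by (simp add: is_rule_base_def) (simp add: tuza_rule_def)

text \<open>A pass is a function and the halting test decides which of the two rules applies. Hence
  the definite description in \<open>rounds\<close> denotes the actual number of rounds.\<close>

lemma olg_col_deterministic:
  assumes "olg_col R G \<rho> L r L'" and "olg_col R G \<rho> L s L''"
  shows "s = r"
  using assms
proof (induction arbitrary: s)
  case (halt L L')
  from halt(3) show ?case by cases (use halt(1,2) in auto)
next
  case (continue L L' r L'')
  from continue.prems show ?case
    by cases (use continue.hyps continue.IH in auto)
qed

section \<open>Propagation of known vertices\<close>

definition spread :: "'a graph \<Rightarrow> 'a \<Rightarrow> 'a set \<Rightarrow> 'a set" where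
  "spread G v K = (if \<exists>u\<in>K. {u, v} \<in> edges G then insert v K else K)"

text \<open>\<open>spread\<close> and \<open>sweep\<close> are the shadows of an update and a pass
  on the set of vertices of known colour. The set is threaded through the vertices in order, so a
  vertex inserted early can inform later ones within the same sweep.\<close>

definition sweep :: "'a graph \<Rightarrow> (nat \<Rightarrow> 'a) \<Rightarrow> 'a set \<Rightarrow> 'a set" where
  "sweep G \<rho> K = foldl (\<lambda>K i. spread G (\<rho> i) K) K [1..<card (verts G) + 1]"

lemma foldl_spread_superset: "K \<subseteq> foldl (\<lambda>K i. spread G (\<rho> i) K) K is"
proof (induction "is" arbitrary: K)
  case (Cons i "is")
  have "K \<subseteq> spread G (\<rho> i) K" by (auto simp: spread_def)
  with Cons show ?case by fastforce
qed simp

lemma sweep_superset: "K \<subseteq> sweep G \<rho> K"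
  unfolding sweep_def by (rule foldl_spread_superset)

lemma funpow_sweep_mono:
  assumes "r \<le> s"
  shows "(sweep G \<rho> ^^ r) K \<subseteq> (sweep G \<rho> ^^ s) K"
  using assms
proof (induction rule: dec_induct)
  case (step n)
  then show ?case using sweep_superset[of "(sweep G \<rho> ^^ n) K" G \<rho>] by auto
qed simp

section \<open>Runs on a two-coloured graph\<close>

locale two_colored_graph =
  fixes G :: "'a graph" and \<rho> :: "nat \<Rightarrow> 'a" and \<gamma> :: "'a \<Rightarrow> nat"
  assumes ocg: "ordered_colored_graph 2 G \<rho> \<gamma>"
begin

text \<open>Every state of a run started from such lists has this form again: with two colours there
  is nothing between a full list and the singleton given by \<gamma>.\<close>

abbreviation known :: "'a set \<Rightarrow> 'a lists" where
  "known K \<equiv> init_lists 2 K \<gamma>"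

lemma finite_verts: "finite (verts G)"
  using ocg by (simp add: ordered_colored_graph_def ordered_graph_def simple_graph_def)

lemma edge_verts:
  assumes "{u, v} \<in> edges G"
  shows "u \<in> verts G" "v \<in> verts G" "u \<noteq> v"
proof -
  have "{u, v} \<subseteq> verts G \<and> card {u, v} = 2"
    using ocg assms by (auto simp: ordered_colored_graph_def ordered_graph_def simple_graph_def)
  then show "u \<in> verts G" "v \<in> verts G" "u \<noteq> v" by auto
qed

lemma color_cases:
  assumes "v \<in> verts G"
  shows "\<gamma> v = 1 \<or> \<gamma> v = 2"
proof -
  have "\<gamma> v \<in> {1..2}"
    using ocg assms by (simp add: ordered_colored_graph_def proper_coloring_def)
  then show ?thesis by auto
qed

lemma edge_colors:
  assumes "{u, v} \<in> edges G"
  shows "\<gamma> u \<noteq> \<gamma> v"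
  using ocg assms by (simp add: ordered_colored_graph_def proper_coloring_def)

lemma rho_bij: "bij_betw \<rho> {1..card (verts G)} (verts G)"
  using ocg by (simp add: ordered_colored_graph_def ordered_graph_def)

section \<open>The effect of one update\<close>

lemma atLeastAtMost_1_2: "{1..2} = {1, 2::nat}"
  by auto

text \<open>An unknown \<open>w\<close> has both colours and deletes nothing. A known
  \<open>w\<close> leaves of a full list exactly \<gamma> v, since the ends of an edge differ; from
  the list of a known \<open>v\<close> it deletes nothing, for the same reason.\<close>

lemma remove_known_color:
  assumes "{w, v} \<in> edges G"
  shows "{c \<in> known K v. \<not> known K w \<subseteq> {c}} = known (if w \<in> K then insert v K else K) v"
  using color_cases[OF edge_verts(1)[OF assms]] color_cases[OF edge_verts(2)[OF assms]]
    edge_colors[OF assms]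
  unfolding init_lists_def atLeastAtMost_1_2 by auto

lemma known_fun_upd:
  "(known K)(v := known (if P then insert v K else K) v) = known (if P then insert v K else K)"
  by (auto simp: init_lists_def fun_eq_iff)

lemma apply_copy_tuza:
  assumes edge: "{\<rho> p, \<rho> q} \<in> edges G"
  shows "apply_copy tuza_rule \<rho> v (known K) [p, q] =
    known (if \<exists>u\<in>K. {u, v} = {\<rho> p, \<rho> q} then insert v K else K)"
proof -
  let ?m = "copy_map \<rho> [p, q]"
  have m: "?m 0 = \<rho> p" "?m (Suc 0) = \<rho> q" by (simp_all add: copy_map_def)
  have ne: "\<rho> p \<noteq> \<rho> q" by (rule edge_verts(3)[OF edge])
  have inj: "inj_on ?m {0, 1}" using ne by (auto simp: inj_on_def m)
  consider "v = \<rho> p" | "v = \<rho> q" | "v \<noteq> \<rho> p" "v \<noteq> \<rho> q" by blast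
  then show ?thesis
  proof cases
    case 1
    have inv: "inv_into {0, Suc 0} ?m (\<rho> p) = 0"
      using inv_into_f_f[OF inj, of 0] by (simp add: m)
    have edge': "{\<rho> q, v} \<in> edges G" using edge 1 by (simp add: insert_commute)
    have "apply_copy tuza_rule \<rho> v (known K) [p, q] =
        (known K)(v := {c \<in> known K v. \<not> known K (\<rho> q) \<subseteq> {c}})"
      using 1 by (auto simp: apply_copy_def tuza_rule_def m inv doubleton_eq_iff)
    also have "\<dots> = known (if \<rho> q \<in> K then insert v K else K)"
      by (simp only: remove_known_color[OF edge'] known_fun_upd)
    also have "(\<rho> q \<in> K) = (\<exists>u\<in>K. {u, v} = {\<rho> p, \<rho> q})"
      using 1 ne by (auto simp: doubleton_eq_iff)
    finally show ?thesis .
  next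
    case 2
    \<comment> \<open>Label 1 of \<open>K2\<close> has label 0 as its only neighbour, so the
      quantifier left by the rule collapses to that label.\<close>
    have all: "(\<forall>u. 0 < u \<or> Q u) \<longleftrightarrow> Q 0" for Q :: "nat \<Rightarrow> bool"
      by (metis gr0I less_irrefl)
    have inv: "inv_into {0, Suc 0} ?m (\<rho> q) = Suc 0"
      using inv_into_f_f[OF inj, of "Suc 0"] by (simp add: m)
    have edge': "{\<rho> p, v} \<in> edges G" using edge 2 by simp
    have "apply_copy tuza_rule \<rho> v (known K) [p, q] =
        (known K)(v := {c \<in> known K v. \<not> known K (\<rho> p) \<subseteq> {c}})"
      using 2 by (auto simp: apply_copy_def tuza_rule_def m inv doubleton_eq_iff all)
    also have "\<dots> = known (if \<rho> p \<in> K then insert v K else K)"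
      by (simp only: remove_known_color[OF edge'] known_fun_upd)
    also have "(\<rho> p \<in> K) = (\<exists>u\<in>K. {u, v} = {\<rho> p, \<rho> q})"
      using 2 ne by (auto simp: doubleton_eq_iff)
    finally show ?thesis .
  next
    case 3
    then have "\<not> (\<exists>u\<in>K. {u, v} = {\<rho> p, \<rho> q})" by (auto simp: doubleton_eq_iff)
    then show ?thesis using 3 by (auto simp: apply_copy_def tuza_rule_def m)
  qed
qed

text \<open>Only \<open>v\<close> can become known while the copies are processed, and after that
  further copies change nothing. So every copy may be tested against the original
  \<open>K\<close>.\<close>

lemma foldl_apply_copy_tuza:
  assumes "\<forall>ps\<in>set pss. \<exists>p q. ps = [p, q] \<and> {\<rho> p, \<rho> q} \<in> edges G"
  shows "foldl (apply_copy tuza_rule \<rho> v) (known K) pss =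
    known (if \<exists>u\<in>K. \<exists>p q. [p, q] \<in> set pss \<and> {u, v} = {\<rho> p, \<rho> q} then insert v K else K)"
  using assms
proof (induction pss arbitrary: K)
  case (Cons ps pss)
  obtain p q where pq: "ps = [p, q]" "{\<rho> p, \<rho> q} \<in> edges G" using Cons.prems by auto
  define K' where "K' = (if \<exists>u\<in>K. {u, v} = {\<rho> p, \<rho> q} then insert v K else K)"
  have "foldl (apply_copy tuza_rule \<rho> v) (known K) (ps # pss) =
      foldl (apply_copy tuza_rule \<rho> v) (known K') pss"
    by (simp add: pq(1) apply_copy_tuza[OF pq(2)] K'_def)
  also have "\<dots> = known (if \<exists>u\<in>K'. \<exists>p q. [p, q] \<in> set pss \<and> {u, v} = {\<rho> p, \<rho> q}
      then insert v K' else K')"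
    using Cons by simp
  also have "(if \<exists>u\<in>K'. \<exists>p q. [p, q] \<in> set pss \<and> {u, v} = {\<rho> p, \<rho> q} then insert v K' else K') =
      (if \<exists>u\<in>K. \<exists>p q. [p, q] \<in> set (ps # pss) \<and> {u, v} = {\<rho> p, \<rho> q} then insert v K else K)"
  proof (cases "\<exists>u\<in>K. {u, v} = {\<rho> p, \<rho> q}")
    case True
    then have "K' = insert v K" by (simp add: K'_def)
    moreover have "\<exists>u\<in>K. \<exists>p q. [p, q] \<in> set (ps # pss) \<and> {u, v} = {\<rho> p, \<rho> q}"
      using True unfolding pq(1) by (metis list.set_intros(1))
    ultimately show ?thesis by simp
  next
    case False
    then have "K' = K" by (simp add: K'_def)
    moreover have "(\<exists>u\<in>K. \<exists>p q. [p, q] \<in> set (ps # pss) \<and> {u, v} = {\<rho> p, \<rho> q}) =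
        (\<exists>u\<in>K. \<exists>p q. [p, q] \<in> set pss \<and> {u, v} = {\<rho> p, \<rho> q})"
      using False pq(1) by auto
    ultimately show ?thesis by (simp only:)
  qed
  finally show ?case .
qed simp

lemma set_copies_K2:
  "set (copies G \<rho> 1 K2 v) = {ps. \<exists>p q. ps = [p, q] \<and> p \<noteq> q \<and> {p, q} \<subseteq> {1..card (verts G)} \<and>
     {\<rho> p, \<rho> q} \<subseteq> ball_around G 1 v \<and> {\<rho> p, \<rho> q} \<in> edges G}" (is "_ = ?C")
proof -
  let ?S = "{ps. length ps = card (verts K2) \<and> distinct ps \<and> set ps \<subseteq> {1..card (verts G)} \<and>
    copy_map \<rho> ps ` verts K2 \<subseteq> ball_around G 1 v \<and> (\<forall>e\<in>edges K2. copy_map \<rho> ps ` e \<in> edges G)}"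
  \<comment> \<open>Finiteness is what allows the set to be read back from
    \<open>sorted_list_of_set\<close>.\<close>
  have "finite {ps. set ps \<subseteq> {1..card (verts G)} \<and> length ps = 2}"
    by (rule finite_lists_length_eq) simp
  then have "finite ?S" by (rule rev_finite_subset) auto
  moreover have "?S = ?C"
    by (auto simp: copy_map_def length_Suc_conv numeral_2_eq_2)
  ultimately show ?thesis by (simp add: copies_def)
qed

lemma ball_around_edge:
  assumes "{u, v} \<in> edges G"
  shows "{u, v} \<subseteq> ball_around G 1 v"
proof -
  have "(v, u) \<in> adj_rel G ^^ 1" using assms by (simp add: adj_rel_def insert_commute)
  moreover have "(v, v) \<in> adj_rel G ^^ 0" by simp
  ultimately have "dist_le G 1 v u" "dist_le G 1 v v" unfolding dist_le_def by blast+
  then show ?thesis using edge_verts[OF assms] by (simp add: ball_around_def)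
qed

text \<open>Every edge at \<open>v\<close> lies in the ball of radius 1, so the copies that have
  \<open>v\<close> as an end are exactly the edges at \<open>v\<close>; all other copies leave its
  list alone.\<close>

lemma update_known: "update tuza_base G \<rho> v (known K) = known (spread G v K)"
proof -
  let ?C = "set (copies G \<rho> 1 K2 v)"
  have C: "\<forall>ps\<in>?C. \<exists>p q. ps = [p, q] \<and> {\<rho> p, \<rho> q} \<in> edges G"
    unfolding set_copies_K2 by auto
  have "(\<exists>u\<in>K. \<exists>p q. [p, q] \<in> ?C \<and> {u, v} = {\<rho> p, \<rho> q}) = (\<exists>u\<in>K. {u, v} \<in> edges G)"
  proof
    assume "\<exists>u\<in>K. \<exists>p q. [p, q] \<in> ?C \<and> {u, v} = {\<rho> p, \<rho> q}"
    then obtain u p q where "u \<in> K" "[p, q] \<in> ?C" "{u, v} = {\<rho> p, \<rho> q}" by blast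
    moreover have "{\<rho> p, \<rho> q} \<in> edges G" using C \<open>[p, q] \<in> ?C\<close> by auto
    ultimately show "\<exists>u\<in>K. {u, v} \<in> edges G" by metis
  next
    assume "\<exists>u\<in>K. {u, v} \<in> edges G"
    then obtain u where u: "u \<in> K" "{u, v} \<in> edges G" by blast
    have im: "verts G = \<rho> ` {1..card (verts G)}" using rho_bij by (simp add: bij_betw_def)
    obtain p where p: "p \<in> {1..card (verts G)}" "u = \<rho> p" using edge_verts(1)[OF u(2)] im by blast
    obtain q where q: "q \<in> {1..card (verts G)}" "v = \<rho> q" using edge_verts(2)[OF u(2)] im by blast
    have "[p, q] \<in> ?C"
      using p q u(2) ball_around_edge[OF u(2)] edge_verts(3)[OF u(2)]
      unfolding set_copies_K2 by auto
    then show "\<exists>u\<in>K. \<exists>p q. [p, q] \<in> ?C \<and> {u, v} = {\<rho> p, \<rho> q}" using u(1) p(2) q(2) by blast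
  qed
  moreover have "fst tuza_rule = K2" by (simp add: tuza_rule_def)
  ultimately show ?thesis
    using foldl_apply_copy_tuza[OF C, of v K]
    by (simp add: update_def structural_update_def spread_def)
qed

section \<open>Passes and rounds\<close>

lemma known_nonempty: "known K v \<noteq> {}"
  by (simp add: init_lists_def)

text \<open>No list of this form is empty, so the failure branch is never taken.\<close>

lemma pass_known: "pass tuza_base G \<rho> (known K) = Some (known (sweep G \<rho> K))"
proof -
  have "foldl (\<lambda>s i. Option.bind s (update_step tuza_base G \<rho> (\<rho> i))) (Some (known K)) is =
      Some (known (foldl (\<lambda>K i. spread G (\<rho> i) K) K is))" for "is" K
    by (induction "is" arbitrary: K) (simp_all add: update_step_def update_known known_nonempty)
  then show ?thesis by (simp only: pass_def sweep_def)
qed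

lemma all_known_iff: "(\<forall>v\<in>verts G. card (known K v) = 1) \<longleftrightarrow> verts G \<subseteq> K"
  by (auto simp: init_lists_def split: if_splits)

text \<open>Each round performs one sweep. The bound \<open>1 \<le> r\<close> holds because a run
  makes at least one pass; later it makes the index at least the cardinality. The equation for
  \<open>L\<close> is a premise of its own so that \<open>K\<close> can vary in the
  induction.\<close>

lemma olg_col_known_imp:
  assumes "olg_col tuza_base G \<rho> L r L'" and "L = known K"
  shows "1 \<le> r" and "L' = known ((sweep G \<rho> ^^ r) K)" and "verts G \<subseteq> (sweep G \<rho> ^^ r) K"
proof -
  have "1 \<le> r \<and> L' = known ((sweep G \<rho> ^^ r) K) \<and> verts G \<subseteq> (sweep G \<rho> ^^ r) K"
    using assms
  proof (induction arbitrary: K)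
    case (halt L L')
    then have "L' = known (sweep G \<rho> K)" by (simp add: pass_known)
    then show ?case using halt all_known_iff by simp
  next
    case (continue L L' r L'')
    then have "L' = known (sweep G \<rho> K)" by (simp add: pass_known)
    from continue.IH[OF this] show ?case by (simp add: funpow_Suc_right del: funpow.simps)
  qed
  then show "1 \<le> r" "L' = known ((sweep G \<rho> ^^ r) K)" "verts G \<subseteq> (sweep G \<rho> ^^ r) K" by auto
qed

text \<open>The run may halt before the given number of sweeps, hence only a bound on
  \<open>r\<close>. The successor reflects that one pass is always made.\<close>

lemma olg_col_known_exists:
  assumes "verts G \<subseteq> (sweep G \<rho> ^^ Suc s) K"
  shows "\<exists>r\<le>Suc s. \<exists>L'. olg_col tuza_base G \<rho> (known K) r L'"
  using assms
proof (induction s arbitrary: K)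
  case 0
  then have "verts G \<subseteq> sweep G \<rho> K" by simp
  then have "olg_col tuza_base G \<rho> (known K) 1 (known (sweep G \<rho> K))"
    by (intro olg_col.halt pass_known) (simp only: all_known_iff)
  then show ?case by auto
next
  case (Suc s)
  show ?case
  proof (cases "verts G \<subseteq> sweep G \<rho> K")
    case True
    then have "olg_col tuza_base G \<rho> (known K) 1 (known (sweep G \<rho> K))"
      by (intro olg_col.halt pass_known) (simp only: all_known_iff)
    then show ?thesis by (intro exI[of _ 1]) auto
  next
    case False
    have "verts G \<subseteq> (sweep G \<rho> ^^ Suc s) (sweep G \<rho> K)"
      using Suc.prems by (simp only: funpow_Suc_right[of "Suc s"] o_def)
    from Suc.IH[OF this] obtain r L' where
      r: "r \<le> Suc s" "olg_col tuza_base G \<rho> (known (sweep G \<rho> K)) r L'" by blast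
    have "olg_col tuza_base G \<rho> (known K) (Suc r) L'"
      by (rule olg_col.continue[OF pass_known _ r(2)])
        (simp only: all_known_iff False not_False_eq_True)
    then show ?thesis using r(1) by blast
  qed
qed

lemma rounds_eq:
  assumes "olg_col tuza_base G \<rho> (known A) r L'"
  shows "rounds tuza_base G \<rho> (known A) = r"
  unfolding rounds_def using assms olg_col_deterministic[OF assms] by blast

section \<open>Defining sets expressed by sweeps\<close>

lemma seq_defining_set_imp:
  assumes "seq_defining_set k G \<rho> \<gamma> tuza_base A"
  shows "A \<subseteq> verts G" and "1 \<le> rounds tuza_base G \<rho> (known A)"
    and "rounds tuza_base G \<rho> (known A) \<le> k"
    and "verts G \<subseteq> (sweep G \<rho> ^^ rounds tuza_base G \<rho> (known A)) A"
proof -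
  obtain r L' where r: "olg_col tuza_base G \<rho> (known A) r L'"
    using assms by (auto simp: seq_defining_set_def Let_def)
  show "A \<subseteq> verts G" "rounds tuza_base G \<rho> (known A) \<le> k"
    using assms by (auto simp: seq_defining_set_def Let_def)
  show "1 \<le> rounds tuza_base G \<rho> (known A)"
    "verts G \<subseteq> (sweep G \<rho> ^^ rounds tuza_base G \<rho> (known A)) A"
    using olg_col_known_imp[OF r refl] by (simp_all add: rounds_eq[OF r])
qed

text \<open>Once all vertices are known, the lists returned are those of the proper colouring
  \<gamma>, which gives solvability and the required output together.\<close>

lemma seq_defining_setI:
  assumes "A \<subseteq> verts G" and "1 \<le> k" and "verts G \<subseteq> (sweep G \<rho> ^^ k) A"
  shows "seq_defining_set k G \<rho> \<gamma> tuza_base A"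
proof -
  have "verts G \<subseteq> (sweep G \<rho> ^^ Suc (k - 1)) A" using assms(2,3) by simp
  then obtain r L' where r: "r \<le> k" "olg_col tuza_base G \<rho> (known A) r L'"
    using olg_col_known_exists[of "k - 1" A] assms(2) by auto
  have L': "\<forall>v\<in>verts G. L' v = {\<gamma> v}"
    using olg_col_known_imp[OF r(2) refl] by (auto simp: init_lists_def)
  moreover have "proper_coloring 2 G \<gamma>" using ocg by (simp add: ordered_colored_graph_def)
  ultimately have "solvable tuza_base G \<rho> (known A)"
    using r(2) unfolding solvable_def tuza_base_simps by blast
  then show ?thesis
    using assms(1) r L' rounds_eq[OF r(2)] unfolding seq_defining_set_def by auto
qed

lemma finite_seq_defining_sets: "finite {A. seq_defining_set k G \<rho> \<gamma> tuza_base A}"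
  by (rule finite_subset[OF _ finite_Pow_iff[THEN iffD2, OF finite_verts]])
    (auto dest: seq_defining_set_imp(1))

lemma Wsdn_eqI:
  assumes "seq_defining_set k G \<rho> \<gamma> tuza_base A" and "card A = m"
    and "\<And>B. seq_defining_set k G \<rho> \<gamma> tuza_base B \<Longrightarrow> m \<le> card B"
  shows "Wsdn k G \<rho> \<gamma> tuza_base = m"
  unfolding Wsdn_def using assms by (intro Min_eqI finite_imageI finite_seq_defining_sets) auto

lemma Ssdn_eqI:
  assumes "seq_defining_set k G \<rho> \<gamma> tuza_base A" and "defining_index G \<rho> \<gamma> tuza_base A \<le> m"
    and "\<And>B. seq_defining_set k G \<rho> \<gamma> tuza_base B \<Longrightarrow> m \<le> defining_index G \<rho> \<gamma> tuza_base B"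
  shows "Ssdn k G \<rho> \<gamma> tuza_base = m"
proof -
  have "defining_index G \<rho> \<gamma> tuza_base A = m" using assms by (meson le_antisym)
  then show ?thesis unfolding Ssdn_def
    using assms by (intro Min_eqI finite_imageI finite_seq_defining_sets) auto
qed

end

section \<open>The spider\<close>

text \<open>The vertices \<open>1, \<dots>, M\<close> are the tips, \<open>M * m + 1\<close> is the centre, and each leg is a residue class
  modulo \<open>M\<close>.\<close>

definition spider :: "nat \<Rightarrow> nat \<Rightarrow> nat graph" where
  "spider M m = \<lparr>verts = {1..M * m + 1},
     edges = {{v, min (v + M) (M * m + 1)} | v. v \<in> {1..M * m}}\<rparr>"

text \<open>The parity of the distance to the centre.\<close>

definition spider_col :: "nat \<Rightarrow> nat \<Rightarrow> nat \<Rightarrow> nat" where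
  "spider_col M m v = 1 + ((M * m + 1 - v + M - 1) div M) mod 2"

locale spider_graph =
  fixes M k :: nat
  assumes M_pos: "1 \<le> M" and k_pos: "1 \<le> k"
begin

definition n :: nat where "n = M * (k + 1) + 1"
definition S :: "nat graph" where "S = spider M (k + 1)"
definition \<gamma> :: "nat \<Rightarrow> nat" where "\<gamma> = spider_col M (k + 1)"

lemma \<gamma>_eq: "\<gamma> v = 1 + ((n - v + M - 1) div M) mod 2"
  by (simp only: \<gamma>_def spider_col_def n_def)

lemma verts_S: "verts S = {1..n}"
  by (simp add: S_def n_def spider_def)

lemma edges_S_eq: "edges S = {{v, min (v + M) n} | v. 1 \<le> v \<and> v < n}"
  by (simp add: S_def n_def spider_def less_Suc_eq_le)

lemma edges_S: "{u, v} \<in> edges S \<longleftrightarrow>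
    (1 \<le> u \<and> u < n \<and> v = min (u + M) n) \<or> (1 \<le> v \<and> v < n \<and> u = min (v + M) n)"
  by (auto simp: edges_S_eq doubleton_eq_iff)

text \<open>The quotient in the colouring is the ceiling of \<open>(n - v) / M\<close>, the distance
  from \<open>v\<close> to the centre. One step inwards lowers it by one.\<close>

lemma spider_col_parent:
  assumes "1 \<le> v" "v < n"
  shows "\<gamma> v \<noteq> \<gamma> (min (v + M) n)"
proof -
  have step: "(a + M) div M = Suc (a div M)" for a using div_add_self2[of M a] M_pos by simp
  have "(n - v + M - 1) div M = Suc ((n - min (v + M) n + M - 1) div M)"
  proof (cases "v + M \<le> n")
    case True
    then have eq: "n - v + M - 1 = (n - min (v + M) n + M - 1) + M" using M_pos by auto
    show ?thesis unfolding eq by (rule step)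
  next
    \<comment> \<open>Here \<open>min\<close> truncates: \<open>v\<close> is a neighbour of the
      centre, and the two quotients are 1 and 0.\<close>
    case False
    then have eq: "n - v + M - 1 = (n - v - 1) + M" and "n - v - 1 < M" using assms by auto
    then have "(n - v - 1) div M = 0" by simp
    then show ?thesis unfolding eq step using M_pos False by simp
  qed
  moreover have "1 + Suc x mod 2 \<noteq> 1 + x mod 2" for x :: nat by presburger
  ultimately show ?thesis by (simp only: \<gamma>_eq not_False_eq_True)
qed

lemma ordered_colored_spider: "ordered_colored_graph 2 S (\<lambda>i. i) \<gamma>"
proof -
  have "e \<subseteq> {1..n} \<and> card e = 2" if e: "e \<in> edges S" for e
  proof -
    obtain v where v: "1 \<le> v" "v < n" "e = {v, min (v + M) n}"
      using e by (auto simp: edges_S_eq)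
    have "v < min (v + M) n" using v M_pos by simp
    then show ?thesis using v by auto
  qed
  then have "ordered_graph S (\<lambda>i. i)"
    by (auto simp: ordered_graph_def simple_graph_def verts_S bij_betw_def)
  moreover have "\<gamma> v \<in> {1..2}" for v
    by (simp add: \<gamma>_eq)
  moreover have "\<gamma> u \<noteq> \<gamma> v" if "{u, v} \<in> edges S" for u v
    using that spider_col_parent by (metis edges_S)
  ultimately show ?thesis by (simp add: ordered_colored_graph_def proper_coloring_def)
qed

sublocale two_colored_graph S "\<lambda>i. i" \<gamma>
  using ordered_colored_spider by unfold_locales

lemma sweep_S: "sweep S (\<lambda>i. i) K = foldl (\<lambda>K i. spread S i K) K [1..<n + 1]"
  by (simp add: sweep_def verts_S)

text \<open>\<open>P i\<close> describes the known set after the vertices 1 to \<open>i\<close> have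
  been processed; the induction runs over the prefixes of the sweep.\<close>

lemma sweep_S_invariant:
  assumes "P 0 K" and "\<And>i K'. i < n \<Longrightarrow> P i K' \<Longrightarrow> P (Suc i) (spread S (Suc i) K')"
  shows "P n (sweep S (\<lambda>i. i) K)"
proof -
  have "P j (foldl (\<lambda>K i. spread S i K) K [1..<j + 1])" if "j \<le> n" for j
    using that by (induction j) (use assms in auto)
  then show ?thesis by (simp only: sweep_S)
qed

section \<open>Lower bounds: what sweeps cannot reach\<close>

lemma sweep_empty: "sweep S (\<lambda>i. i) {} = {}"
proof -
  have "foldl (\<lambda>K i. spread S i K) {} is = {}" for "is"
    by (induction "is") (simp_all add: spread_def)
  then show ?thesis by (simp only: sweep_S)
qed

text \<open>A necessary condition for \<open>v\<close> to be known after \<open>r\<close> sweeps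
  from \<open>A\<close>. The premise says that \<open>v\<close> is more than \<open>r\<close> steps
  from the centre, too far to be informed through it. A source on the leg of \<open>v\<close> may
  lie anywhere further out, but at most \<open>r\<close> steps further in.\<close>

definition reaches :: "nat set \<Rightarrow> nat \<Rightarrow> nat \<Rightarrow> bool" where
  "reaches A r v \<longleftrightarrow> (v + r * M < n \<longrightarrow> (\<exists>a\<in>A. a \<le> v + r * M \<and> a mod M = v mod M))"

lemma reaches_sweep:
  assumes "\<forall>v\<in>K. reaches A r v"
  shows "\<forall>v\<in>sweep S (\<lambda>i. i) K. reaches A (Suc r) v"
proof -
  have Suc: "reaches A (Suc r) v" if "reaches A r v" for v
    unfolding reaches_def
  proof
    assume "v + Suc r * M < n"
    then have "v + r * M < n" by simp
    with that obtain a where "a \<in> A" "a \<le> v + r * M" "a mod M = v mod M"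
      by (auto simp: reaches_def)
    then show "\<exists>a\<in>A. a \<le> v + Suc r * M \<and> a mod M = v mod M"
      by (intro bexI[of _ a]) simp_all
  qed
  \<comment> \<open>In the middle of a sweep, vertices after position \<open>i\<close> still satisfy the old bound.\<close>
  define P where "P i K' \<longleftrightarrow>
    (\<forall>v\<in>K'. reaches A (Suc r) v \<and> (i < v \<longrightarrow> reaches A r v))" for i K'
  have "P n (sweep S (\<lambda>i. i) K)"
  proof (rule sweep_S_invariant)
    show "P 0 K" using assms Suc by (simp add: P_def)
  next
    fix i K'
    assume i: "i < n" and P: "P i K'"
    have "reaches A (Suc r) (Suc i)" if u: "u \<in> K'" "{u, Suc i} \<in> edges S" for u
      unfolding reaches_def
    proof
      assume less: "Suc i + Suc r * M < n"
      show "\<exists>a\<in>A. a \<le> Suc i + Suc r * M \<and> a mod M = Suc i mod M"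
      proof (cases "u = Suc i + M")
        \<comment> \<open>The informant lies one step further in and has not yet been processed in
          this sweep, so the old bound holds for it. The shift by \<open>M\<close> accounts for the
          additional sweep.\<close>
        case True
        then have "reaches A r u" using P u(1) by (auto simp: P_def)
        then obtain a where "a \<in> A" "a \<le> u + r * M" "a mod M = u mod M"
          using less True by (auto simp: reaches_def)
        then show ?thesis using True by (intro bexI[of _ a]) (auto simp flip: add_Suc)
      next
        case False
        \<comment> \<open>Truncation at the centre is excluded by \<open>less\<close>, so the
          informant lies one step further out, and its new bound is stronger than the one
          required.\<close>
        then have ui: "Suc i = u + M" using u(2) less unfolding edges_S
          by (auto simp: min_def split: if_splits)
        have "reaches A (Suc r) u" using P u(1) by (auto simp: P_def)
        then obtain a where "a \<in> A" "a \<le> u + Suc r * M" "a mod M = u mod M"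
          using less ui by (auto simp: reaches_def)
        then show ?thesis using ui by (intro bexI[of _ a]) auto
      qed
    qed
    then show "P (Suc i) (spread S (Suc i) K')"
      using P by (auto simp: P_def spread_def)
  qed
  then show ?thesis by (simp add: P_def)
qed

lemma reaches_funpow_sweep:
  "\<forall>v\<in>(sweep S (\<lambda>i. i) ^^ r) A. reaches A r v"
proof (induction r)
  case 0
  then show ?case by (auto simp: reaches_def)
qed (simp add: reaches_sweep)

text \<open>Each tip is \<open>k + 1\<close> steps from the centre, so after \<open>k\<close> sweeps
  it can be known only if its own leg contains an element of \<open>A\<close>.\<close>

lemma card_ge_M:
  assumes "finite A" and "verts S \<subseteq> (sweep S (\<lambda>i. i) ^^ k) A"
  shows "M \<le> card A"
proof -
  have "\<exists>a\<in>A. a mod M = v" if "v < M" for v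
  proof -
    \<comment> \<open>\<open>w\<close> is the tip in the residue class \<open>v\<close>; vertices
      start at 1, so class 0 has tip \<open>M\<close>.\<close>
    define w where "w = (if v = 0 then M else v)"
    have w: "1 \<le> w" "w \<le> M" "w mod M = v" using that M_pos by (auto simp: w_def)
    have "w \<le> n" using w by (simp add: n_def trans_le_add1)
    then have "reaches A k w"
      using reaches_funpow_sweep[of k A] assms(2) w by (auto simp: verts_S)
    moreover have "w + k * M < n" using w by (simp add: n_def algebra_simps)
    ultimately show ?thesis using w(3) by (auto simp: reaches_def)
  qed
  then have "{..<M} \<subseteq> (\<lambda>a. a mod M) ` A" by force
  from surj_card_le[OF assms(1) this] show ?thesis by simp
qed

section \<open>Upper bounds: the tips and the centre\<close>

lemma sweep_tips: "verts S \<subseteq> sweep S (\<lambda>i. i) {1..M}"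
proof -
  define P where "P i K \<longleftrightarrow> {1..i} \<union> {1..M} \<subseteq> K" for i :: nat and K :: "nat set"
  have "P n (sweep S (\<lambda>i. i) {1..M})"
  proof (rule sweep_S_invariant)
    show "P 0 {1..M}" by (simp add: P_def)
  next
    fix i K
    assume i: "i < n" and P: "P i K"
    show "P (Suc i) (spread S (Suc i) K)"
    proof (cases "Suc i \<le> M")
      case True
      then have "Suc i \<in> K" using P by (auto simp: P_def)
      then show ?thesis using P by (auto simp: P_def spread_def le_Suc_eq)
    next
      case False
      \<comment> \<open>The neighbour further out precedes \<open>Suc i\<close> in the order, so one
        sweep carries the colours all the way to the centre.\<close>
      have "{Suc i - M, Suc i} \<in> edges S" unfolding edges_S using i False M_pos by auto
      moreover have "Suc i - M \<in> {1..i}" using False M_pos by auto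
      then have "Suc i - M \<in> K" using P unfolding P_def by blast
      ultimately show ?thesis using P by (auto simp: P_def spread_def le_Suc_eq)
    qed
  qed
  then show ?thesis by (auto simp: P_def verts_S)
qed

text \<open>\<open>n \<le> v + r * M\<close> says that \<open>v\<close> is within \<open>r\<close>
  steps of the centre. A sweep enlarges this radius by one, since the neighbour further in was known
  before.\<close>

lemma sweep_outwards:
  assumes "\<forall>v. 1 \<le> v \<and> v \<le> n \<and> n \<le> v + r * M \<longrightarrow> v \<in> K"
  shows "\<forall>v. 1 \<le> v \<and> v \<le> n \<and> n \<le> v + Suc r * M \<longrightarrow> v \<in> sweep S (\<lambda>i. i) K"
proof -
  define P where "P i K' \<longleftrightarrow> K \<subseteq> K' \<and>
    (\<forall>v. 1 \<le> v \<and> v \<le> i \<and> n \<le> v + Suc r * M \<longrightarrow> v \<in> K')" for i K'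
  have "P n (sweep S (\<lambda>i. i) K)"
  proof (rule sweep_S_invariant)
    show "P 0 K" by (simp add: P_def)
  next
    fix i K'
    assume i: "i < n" and P: "P i K'"
    have "Suc i \<in> spread S (Suc i) K'" if le: "n \<le> Suc i + Suc r * M"
    proof (cases "Suc i = n")
      \<comment> \<open>The centre has no neighbour further in, but it lies in \<open>K\<close> by
        assumption.\<close>
      case True
      then show ?thesis using assms P by (auto simp: P_def spread_def)
    next
      case False
      let ?u = "min (Suc i + M) n"
      have "{?u, Suc i} \<in> edges S" unfolding edges_S using i False by simp
      moreover have "?u \<in> K'"
      proof -
        have "1 \<le> ?u \<and> ?u \<le> n \<and> n \<le> ?u + r * M" using le i by auto
        then show ?thesis using assms P unfolding P_def by blast
      qed
      ultimately show ?thesis by (auto simp: spread_def)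
    qed
    then show "P (Suc i) (spread S (Suc i) K')"
      using P by (auto simp: P_def spread_def le_Suc_eq)
  qed
  then show ?thesis by (simp add: P_def)
qed

lemma sweep_centre: "verts S \<subseteq> (sweep S (\<lambda>i. i) ^^ (k + 1)) {n}"
proof -
  have "\<forall>v. 1 \<le> v \<and> v \<le> n \<and> n \<le> v + r * M \<longrightarrow> v \<in> (sweep S (\<lambda>i. i) ^^ r) {n}" for r
  proof (induction r)
    case (Suc r)
    from sweep_outwards[OF this] show ?case by simp
  qed simp
  from this[of "k + 1"] show ?thesis by (auto simp: verts_S n_def algebra_simps)
qed

lemma seq_defining_set_tips:
  assumes "1 \<le> j"
  shows "seq_defining_set j S (\<lambda>i. i) \<gamma> tuza_base {1..M}"
proof (rule seq_defining_setI)
  show "{1..M} \<subseteq> verts S" by (auto simp: verts_S n_def)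
  show "verts S \<subseteq> (sweep S (\<lambda>i. i) ^^ j) {1..M}"
    using sweep_tips funpow_sweep_mono[OF assms, of S "\<lambda>i. i" "{1..M}"] by simp
qed (fact assms)

lemma seq_defining_set_centre: "seq_defining_set (k + 1) S (\<lambda>i. i) \<gamma> tuza_base {n}"
proof (rule seq_defining_setI)
  show "{n} \<subseteq> verts S" by (simp add: verts_S n_def)
qed (simp, rule sweep_centre)

lemma seq_defining_set_card:
  assumes "seq_defining_set j S (\<lambda>i. i) \<gamma> tuza_base A"
  shows "1 \<le> card A" and "rounds tuza_base S (\<lambda>i. i) (known A) \<le> k \<Longrightarrow> M \<le> card A"
proof -
  note A = seq_defining_set_imp[OF assms]
  have fin: "finite A" using A(1) finite_verts by (rule finite_subset)
  have "(sweep S (\<lambda>i. i) ^^ r) {} = {}" for r by (induction r) (simp_all add: sweep_empty)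
  moreover have "1 \<in> verts S" by (simp add: verts_S n_def)
  ultimately have "A \<noteq> {}" using A(4) by auto
  then show "1 \<le> card A" using fin by (simp add: Suc_le_eq card_gt_0_iff)
  show "M \<le> card A" if "rounds tuza_base S (\<lambda>i. i) (known A) \<le> k"
    using card_ge_M[OF fin] A(4) funpow_sweep_mono[OF that, of S "\<lambda>i. i" A] by blast
qed

section \<open>The weak and strong numbers of the spider\<close>

lemma Wsdn_spider: "Wsdn k S (\<lambda>i. i) \<gamma> tuza_base = M"
proof (rule Wsdn_eqI[OF seq_defining_set_tips[OF k_pos]])
  fix B
  assume B: "seq_defining_set k S (\<lambda>i. i) \<gamma> tuza_base B"
  show "M \<le> card B" by (rule seq_defining_set_card(2)[OF B seq_defining_set_imp(3)[OF B]])
qed simp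

lemma Wsdn_spider_Suc: "Wsdn (k + 1) S (\<lambda>i. i) \<gamma> tuza_base = 1"
  by (rule Wsdn_eqI[OF seq_defining_set_centre])
    (simp, erule seq_defining_set_card(1))

lemma Ssdn_spider: "Ssdn k S (\<lambda>i. i) \<gamma> tuza_base = M"
proof (rule Ssdn_eqI[OF seq_defining_set_tips[OF k_pos]])
  \<comment> \<open>The bound 1 is admissible for the tips, so they need a single round and their
    index is at most their number.\<close>
  show "defining_index S (\<lambda>i. i) \<gamma> tuza_base {1..M} \<le> M"
    using seq_defining_set_imp(3)[OF seq_defining_set_tips[OF order_refl]]
    by (simp add: defining_index_def)
next
  fix B
  assume B: "seq_defining_set k S (\<lambda>i. i) \<gamma> tuza_base B"
  show "M \<le> defining_index S (\<lambda>i. i) \<gamma> tuza_base B"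
    using seq_defining_set_imp(2,3)[OF B] seq_defining_set_card(2)[OF B]
    by (simp add: defining_index_def)
qed

text \<open>A set that finishes within \<open>k\<close> rounds has at least \<open>M\<close>
  elements; a slower one takes at least \<open>k + 1\<close> rounds and has at least one element.
  Either way the index is at least \<open>k + 1\<close>.\<close>

lemma Ssdn_spider_Suc:
  assumes "k + 1 \<le> M"
  shows "Ssdn (k + 1) S (\<lambda>i. i) \<gamma> tuza_base = k + 1"
proof (rule Ssdn_eqI[OF seq_defining_set_centre])
  show "defining_index S (\<lambda>i. i) \<gamma> tuza_base {n} \<le> k + 1"
    using seq_defining_set_imp(3)[OF seq_defining_set_centre]
    by (simp add: defining_index_def)
next
  fix B
  assume B: "seq_defining_set (k + 1) S (\<lambda>i. i) \<gamma> tuza_base B"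
  show "k + 1 \<le> defining_index S (\<lambda>i. i) \<gamma> tuza_base B"
  proof (cases "rounds tuza_base S (\<lambda>i. i) (known B) \<le> k")
    case True
    then show ?thesis
      using seq_defining_set_card(2)[OF B] seq_defining_set_imp(2)[OF B] assms
      by (simp add: defining_index_def)
  next
    case False
    then show ?thesis
      using seq_defining_set_card(1)[OF B] by (simp add: defining_index_def)
  qed
qed

end

theorem theorem2:
  fixes \<xi> k :: nat
  assumes "1 \<le> \<xi>" and "1 \<le> k"
  shows "\<exists>(G :: nat graph) \<rho> \<gamma> R (H :: nat graph) \<rho>' \<gamma>' R'.
    is_rule_base R \<and> ordered_colored_graph (num_colors R) G \<rho> \<gamma> \<and>
    is_rule_base R' \<and> ordered_colored_graph (num_colors R') H \<rho>' \<gamma>' \<and>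
    (\<exists>A. seq_defining_set k G \<rho> \<gamma> R A) \<and>
    int (Wsdn k G \<rho> \<gamma> R) - int (Wsdn (k + 1) G \<rho> \<gamma> R) = int \<xi> \<and>
    (\<exists>A. seq_defining_set k H \<rho>' \<gamma>' R' A) \<and>
    int (Ssdn k H \<rho>' \<gamma>' R') - int (Ssdn (k + 1) H \<rho>' \<gamma>' R') = int \<xi>"
proof -
  \<comment> \<open>The weak numbers are \<open>M\<close> and 1, which asks for
    \<open>M = \<xi> + 1\<close>; the strong ones are \<open>M\<close> and \<open>k + 1\<close>,
    which asks for \<open>M = \<xi> + (k + 1)\<close>.\<close>
  interpret W: spider_graph "\<xi> + 1" k using assms by unfold_locales auto
  interpret S: spider_graph "\<xi> + (k + 1)" k using assms by unfold_locales auto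
  have ocg: "ordered_colored_graph (num_colors tuza_base) G \<rho> \<gamma>"
    if "ordered_colored_graph 2 G \<rho> \<gamma>" for G :: "nat graph" and \<rho> \<gamma>
    using that by simp
  have W: "int (Wsdn k W.S (\<lambda>i. i) W.\<gamma> tuza_base) -
      int (Wsdn (k + 1) W.S (\<lambda>i. i) W.\<gamma> tuza_base) = int \<xi>"
    unfolding W.Wsdn_spider W.Wsdn_spider_Suc by simp
  have S: "int (Ssdn k S.S (\<lambda>i. i) S.\<gamma> tuza_base) -
      int (Ssdn (k + 1) S.S (\<lambda>i. i) S.\<gamma> tuza_base) = int \<xi>"
    unfolding S.Ssdn_spider S.Ssdn_spider_Suc[OF le_add2] by simp
  \<comment> \<open>The tips also witness that the minima for the bound \<open>k\<close> range over
    nonempty families.\<close>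
  show ?thesis
    using is_rule_base_tuza_base ocg[OF W.ordered_colored_spider] ocg[OF S.ordered_colored_spider]
      W.seq_defining_set_tips[OF assms(2)] S.seq_defining_set_tips[OF assms(2)] W S
    by blast
qed

end
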